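(* Let $X$ be a topological space. If ${\sf FG}(\Omega_X,\Omega_X)$ holds, then ${\sf NW}(\Omega_X,\Omega_X)$ holds.
   Context: An $\omega$-cover of $X$ is an open cover $\mathcal{U}$ with $X\notin\mathcal{U}$ such that each finite subset of $X$ lies in some member of $\mathcal{U}$; $\Omega_X$ is the set of $\omega$-covers. $[S]^{\aleph_0}$ and $[S]^{<\aleph_0}$ denote the countably infinite and the finite subsets of $S$. For a countably infinite $A$ fix a bijective enumeration $A=\{a_n:n\in\mathbb{N}\}$; for $s,T\subseteq A$, $s<T$ means $a_n\in s$, $a_m\in T$ imply $n<m$; a finite $s\subseteq C$ is an initial segment of $C\subseteq A$ if $s<C\setminus s$. A family $\mathcal{S}\subseteq[A]^{<\aleph_0}$ is dense if $\mathcal{S}\cap[B]^{<\aleph_0}\neq\emptyset$ for every $B\in[A]^{\aleph_0}\cap\Omega_X$, and thin if no element of $\mathcal{S}$ is an initial segment of another element of $\mathcal{S}$. ${\sf FG}(\Omega_X,\Omega_X)$: for every countably infinite $A\in\Omega_X$ and every dense $\mathcal{S}\subseteq[A]^{<\aleph_0}$ there is $B\in[A]^{\aleph_0}\cap\Omega_X$ such that every $C\in[B]^{\aleph_0}\cap\Omega_X$ has an initial segment in $\mathcal{S}$. ${\sf NW}(\Omega_X,\Omega_X)$: for every countably infinite $A\in\Omega_X$, every thin $\mathcal{T}\subseteq[A]^{<\aleph_0}$, every positive integer $n$ and every partition $\mathcal{T}=\mathcal{T}_1\cup\cdots\cup\mathcal{T}_n$ there are $B\in[A]^{\aleph_0}\cap\Omega_X$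 and $i\in\{1,\dots,n\}$ with $[B]^{<\aleph_0}\cap\mathcal{T}\subseteq\mathcal{T}_i$. *)

theory Defs
  imports "HOL-Analysis.Abstract_Topology" "HOL-Library.Countable_Set" "HOL-Library.Disjoint_Sets"
begin

definition omega_cover :: "'a topology \<Rightarrow> 'a set set \<Rightarrow> bool" where
  "omega_cover X \<U> \<longleftrightarrow>
     (\<forall>U\<in>\<U>. openin X U) \<and> \<Union>\<U> = topspace X \<and>
     topspace X \<notin> \<U> \<and>
     (\<forall>F. finite F \<and> F \<subseteq> topspace X \<longrightarrow> (\<exists>U\<in>\<U>. F \<subseteq> U))"

definition Omega :: "'a topology \<Rightarrow> 'a set set set" where
  "Omega X = {\<U>. omega_cover X \<U>}"

definition ctbl_inf_subsets :: "'b set \<Rightarrow> 'b set set" where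
  "ctbl_inf_subsets S = {B. B \<subseteq> S \<and> countable B \<and> infinite B}"

text \<open>
  A simultaneous choice of one bijective enumeration \<open>e A 0, e A 1, \<dots>\<close> for every countably
  infinite set \<open>A\<close>. The order-dependent notions below take the enumeration \<open>a = e A\<close> of the ambient
  set as a parameter; subsets of \<open>A\<close> are always compared in the enumeration of \<open>A\<close>, never in
  their own.
\<close>

definition enumeration_choice :: "('b set \<Rightarrow> nat \<Rightarrow> 'b) \<Rightarrow> bool" where
  "enumeration_choice e \<longleftrightarrow> (\<forall>A. countable A \<and> infinite A \<longrightarrow> bij_betw (e A) UNIV A)"

definition set_before :: "(nat \<Rightarrow> 'b) \<Rightarrow> 'b set \<Rightarrow> 'b set \<Rightarrow> bool" where
  "set_before a s T \<longleftrightarrow> (\<forall>n m. a n \<in> s \<and> a m \<in> T \<longrightarrow> n < m)"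

definition initial_segment :: "(nat \<Rightarrow> 'b) \<Rightarrow> 'b set \<Rightarrow> 'b set \<Rightarrow> bool" where
  "initial_segment a s C \<longleftrightarrow> finite s \<and> s \<subseteq> C \<and> set_before a s (C - s)"

definition dense_family :: "'a topology \<Rightarrow> 'a set set \<Rightarrow> 'a set set set \<Rightarrow> bool" where
  "dense_family X A \<S> \<longleftrightarrow>
     \<S> \<subseteq> Fpow A \<and> (\<forall>B \<in> ctbl_inf_subsets A \<inter> Omega X. \<S> \<inter> Fpow B \<noteq> {})"

definition thin_family :: "(nat \<Rightarrow> 'b) \<Rightarrow> 'b set \<Rightarrow> 'b set set \<Rightarrow> bool" where
  "thin_family a A \<S> \<longleftrightarrow>
     \<S> \<subseteq> Fpow A \<and> (\<forall>s\<in>\<S>. \<forall>t\<in>\<S>. s \<noteq> t \<longrightarrow> \<not> initial_segment a s t)"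

definition FG :: "('a set set \<Rightarrow> nat \<Rightarrow> 'a set) \<Rightarrow> 'a topology \<Rightarrow> bool" where
  "FG e X \<longleftrightarrow>
     (\<forall>A \<S>. A \<in> Omega X \<and> countable A \<and> infinite A \<and> dense_family X A \<S> \<longrightarrow>
        (\<exists>B \<in> ctbl_inf_subsets A \<inter> Omega X.
           \<forall>C \<in> ctbl_inf_subsets B \<inter> Omega X. \<exists>s\<in>\<S>. initial_segment (e A) s C))"

text \<open>The pieces of a partition are pairwise disjoint but may be empty.\<close>

definition NW :: "('a set set \<Rightarrow> nat \<Rightarrow> 'a set) \<Rightarrow> 'a topology \<Rightarrow> bool" where
  "NW e X \<longleftrightarrow>
     (\<forall>A \<T> (n::nat) P. A \<in> Omega X \<and> countable A \<and> infinite A \<and> thin_family (e A) A \<T> \<and>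
        n > 0 \<and> \<T> = (\<Union>i\<in>{1..n}. P i) \<and> disjoint_family_on P {1..n} \<longrightarrow>
        (\<exists>B \<in> ctbl_inf_subsets A \<inter> Omega X. \<exists>i\<in>{1..n}. Fpow B \<inter> \<T> \<subseteq> P i))"

end

theory Submission imports Defs begin

text \<open>
  For two pieces, either \<open>\<T>\<^sub>1\<close> is not dense, and some \<open>B\<close> avoids it, or FG yields \<open>B\<close> all of whose
  \<open>\<omega>\<close>-subcovers have an initial segment in \<open>\<T>\<^sub>1\<close>. Since \<open>\<omega>\<close>-covers survive the removal of finitely
  many members, each finite \<open>s \<subseteq> B\<close> is an initial segment of some \<open>\<omega>\<close>-subcover of \<open>B\<close>, so thinness
  forces every \<open>s \<in> \<T>\<close> with \<open>s \<subseteq> B\<close> to lie in \<open>\<T>\<^sub>1\<close>.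

  Induction on the number of pieces passes to a subcover \<open>B\<close> of \<open>A\<close> but must keep the order
  of \<open>A\<close>, whereas FG applied to \<open>B\<close> speaks about the enumeration of \<open>B\<close>. The family of pairs is
  thin for every order, so the two-piece case is a Ramsey theorem for pairs; applied to the
  colouring "the two orders agree on the pair" it gives a subcover on which the orders coincide.
  Hence FG holds for every order of type \<open>\<omega>\<close>.
\<close>

text \<open>The order \<open>a\<close> is separate from \<open>A\<close> and may enumerate a larger
  set, so a subcover can be compared in the order of the original cover.\<close>

definition FG_on :: "'a topology \<Rightarrow> (nat \<Rightarrow> 'a set) \<Rightarrow> 'a set set \<Rightarrow> bool" where
  "FG_on X a A \<longleftrightarrow>
     (\<forall>\<S>. dense_family X A \<S> \<longrightarrow>
        (\<exists>B \<in> ctbl_inf_subsets A \<inter> Omega X.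
           \<forall>C \<in> ctbl_inf_subsets B \<inter> Omega X. \<exists>s\<in>\<S>. initial_segment a s C))"

lemma ctbl_inf_subsets_trans:
  "B \<in> ctbl_inf_subsets A \<Longrightarrow> C \<in> ctbl_inf_subsets B \<Longrightarrow> C \<in> ctbl_inf_subsets A"
  by (auto simp: ctbl_inf_subsets_def)

text \<open>Each member \<open>U\<close> misses some point \<open>p U\<close>. Adding the points of
  the removed members to a finite \<open>F\<close> forces any member containing the enlarged set to
  lie outside \<open>D\<close>.\<close>

lemma Omega_Diff_finite:
  assumes B: "B \<in> Omega X" and D: "finite D"
  shows "B - D \<in> Omega X"
proof -
  have B_open: "\<And>U. U \<in> B \<Longrightarrow> openin X U" and B_top: "topspace X \<notin> B"
    and B_fin: "\<And>F. finite F \<Longrightarrow> F \<subseteq> topspace X \<Longrightarrow> \<exists>U\<in>B. F \<subseteq> U"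
    using B unfolding Omega_def omega_cover_def by auto
  have "\<forall>U\<in>B. \<exists>x. x \<in> topspace X - U"
  proof
    fix U assume U: "U \<in> B"
    then have "U \<subset> topspace X" using openin_subset[OF B_open] B_top by blast
    then show "\<exists>x. x \<in> topspace X - U" by blast
  qed
  from bchoice[OF this] obtain p where p: "\<And>U. U \<in> B \<Longrightarrow> p U \<in> topspace X - U" by blast
  have fin: "\<exists>U\<in>B - D. F \<subseteq> U" if F: "finite F" "F \<subseteq> topspace X" for F
  proof -
    have "finite (F \<union> p ` (B \<inter> D))" "F \<union> p ` (B \<inter> D) \<subseteq> topspace X"
      using F D p by auto
    from B_fin[OF this] obtain U where U: "U \<in> B" "F \<union> p ` (B \<inter> D) \<subseteq> U" by blast
    have "U \<notin> D" using U p[of U] by auto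
    with U show ?thesis by auto
  qed
  have "topspace X \<subseteq> \<Union>(B - D)"
  proof
    fix x assume "x \<in> topspace X"
    then show "x \<in> \<Union>(B - D)" using fin[of "{x}"] by auto
  qed
  moreover have "\<Union>(B - D) \<subseteq> topspace X" using B_open openin_subset by blast
  ultimately show ?thesis
    unfolding Omega_def omega_cover_def using B_open B_top fin by auto
qed

text \<open>Points \<open>x\<close> of \<open>s - t\<close> and \<open>y\<close> of
  \<open>t - s\<close> would each have to precede the other. Since \<open>set_before\<close>
  constrains only values of \<open>a\<close>, \<open>C\<close> has to lie in its range.\<close>

lemma initial_segments_comparable:
  assumes C: "C \<subseteq> range a" and s: "initial_segment a s C" and t: "initial_segment a t C"
  shows "initial_segment a s t \<or> initial_segment a t s"
proof -
  have "s \<subseteq> t \<or> t \<subseteq> s"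
  proof (rule ccontr)
    assume "\<not> ?thesis"
    then obtain x y where xy: "x \<in> s" "x \<notin> t" "y \<in> t" "y \<notin> s" by auto
    moreover have "x \<in> C" "y \<in> C" using s t xy unfolding initial_segment_def by auto
    moreover obtain n m where "x = a n" "y = a m" using C \<open>x \<in> C\<close> \<open>y \<in> C\<close> by blast
    ultimately have "n < m" "m < n"
      using s t unfolding initial_segment_def set_before_def by auto
    then show False by simp
  qed
  then show ?thesis using s t unfolding initial_segment_def set_before_def by blast
qed

lemma thin_two_pieces:
  assumes a: "inj a" "A \<subseteq> range a" and FG: "FG_on X a A" and A: "A \<in> ctbl_inf_subsets A \<inter> Omega X"
    and thin: "thin_family a A \<T>" and PQ: "\<T> \<subseteq> P \<union> Q"
  shows "\<exists>B \<in> ctbl_inf_subsets A \<inter> Omega X. Fpow B \<inter> \<T> \<subseteq> P \<or> Fpow B \<inter> \<T> \<subseteq> Q"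
proof (cases "dense_family X A (\<T> \<inter> P)")
  case False
  then obtain B where "B \<in> ctbl_inf_subsets A \<inter> Omega X" "\<T> \<inter> P \<inter> Fpow B = {}"
    using thin unfolding dense_family_def thin_family_def by blast
  then show ?thesis using PQ by blast
next
  case True
  then obtain B where B: "B \<in> ctbl_inf_subsets A \<inter> Omega X"
    and seg: "\<And>C. C \<in> ctbl_inf_subsets B \<inter> Omega X \<Longrightarrow> \<exists>s\<in>\<T> \<inter> P. initial_segment a s C"
    using FG unfolding FG_on_def by blast
  have "s \<in> P" if s: "s \<in> Fpow B" "s \<in> \<T>" for s
  proof -
    have fs: "finite s" "s \<subseteq> B" using s by (auto simp: Fpow_def)
    \<comment> \<open>Everything outside \<open>s\<close> that comes before some element of
      \<open>s\<close>. Deleting it makes \<open>s\<close> an initial segment, and injectivity of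
      \<open>a\<close> keeps it finite.\<close>
    define D where "D = a ` (\<Union>n\<in>a -` s. {..n}) - s"
    have "finite (a -` s)" using fs a by (intro finite_vimageI)
    then have D: "finite D" unfolding D_def by auto
    have "infinite (B - D)" using B D by (auto simp: ctbl_inf_subsets_def)
    then have C: "B - D \<in> ctbl_inf_subsets B \<inter> Omega X"
      using B Omega_Diff_finite[OF _ D] by (auto simp: ctbl_inf_subsets_def)
    have s_seg: "initial_segment a s (B - D)"
      unfolding initial_segment_def set_before_def
    proof (intro conjI allI impI)
      show "finite s" "s \<subseteq> B - D" using fs by (auto simp: D_def)
      fix n m assume nm: "a n \<in> s \<and> a m \<in> B - D - s"
      show "n < m"
      proof (rule ccontr)
        assume "\<not> n < m"
        then have "m \<in> (\<Union>n\<in>a -` s. {..n})" using nm by (intro UN_I[of n]) auto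
        then have "a m \<in> D" using nm unfolding D_def by blast
        with nm show False by simp
      qed
    qed
    obtain t where t: "t \<in> \<T>" "t \<in> P" "initial_segment a t (B - D)" using seg[OF C] by auto
    have "B - D \<subseteq> range a" using B a(2) by (auto simp: ctbl_inf_subsets_def)
    then have "s = t"
      using initial_segments_comparable[OF _ s_seg t(3)] thin s(2) t(1)
      unfolding thin_family_def by blast
    with t show ?thesis by simp
  qed
  with B show ?thesis by blast
qed

lemma thin_pairs:
  fixes A :: "'b set"
  shows "thin_family a A {s. s \<subseteq> A \<and> card s = 2}"
proof -
  have "s = t" if "card s = 2" "card t = 2" "initial_segment a s t" for s t :: "'b set"
    using that by (metis card_subset_eq card.infinite initial_segment_def zero_neq_numeral)
  moreover have "finite s" if "card s = 2" for s :: "'b set"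
    using that by (metis card.infinite zero_neq_numeral)
  ultimately show ?thesis unfolding thin_family_def Fpow_def by blast
qed

lemma orders_agree_on_subcover:
  fixes f g :: "'a set \<Rightarrow> nat"
  assumes e: "enumeration_choice e" and FG: "FG e X"
    and A: "A \<in> ctbl_inf_subsets A \<inter> Omega X" and inj: "inj_on f A" "inj_on g A"
  shows "\<exists>B \<in> ctbl_inf_subsets A \<inter> Omega X. \<forall>x\<in>B. \<forall>y\<in>B. f x < f y \<longleftrightarrow> g x < g y"
proof -
  \<comment> \<open>\<open>f\<close> and \<open>g\<close> play the role of positions in two orders;
    a pair lies in \<open>Q\<close> iff both orders arrange it the same way.\<close>
  define Q where "Q = {s. \<forall>x\<in>s. \<forall>y\<in>s. f x < f y \<longleftrightarrow> g x < g y}"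
  have bij: "bij_betw (e A) UNIV A"
    using e A by (auto simp: enumeration_choice_def ctbl_inf_subsets_def)
  have "FG_on X (e A) A" using FG A by (auto simp: FG_def FG_on_def ctbl_inf_subsets_def)
  from thin_two_pieces[OF _ _ this A thin_pairs, of Q "- Q"]
  obtain B where B: "B \<in> ctbl_inf_subsets A \<inter> Omega X"
    and hom: "Fpow B \<inter> {s. s \<subseteq> A \<and> card s = 2} \<subseteq> Q \<or> Fpow B \<inter> {s. s \<subseteq> A \<and> card s = 2} \<subseteq> - Q"
    using bij by (auto simp: bij_betw_def)
  have BA: "B \<subseteq> A" "infinite B" using B by (auto simp: ctbl_inf_subsets_def)
  have pair: "{x, y} \<in> Fpow B \<inter> {s. s \<subseteq> A \<and> card s = 2}" if "x \<in> B" "y \<in> B" "x \<noteq> y" for x y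
    using that BA by (auto simp: Fpow_def)
  \<comment> \<open>If the orders disagreed on every pair, the \<open>f\<close>-least point of
    \<open>B\<close> would be \<open>g\<close>-greatest, and the injective \<open>g\<close> would
    map the infinite \<open>B\<close> into a finite set of naturals.\<close>
  have "\<not> Fpow B \<inter> {s. s \<subseteq> A \<and> card s = 2} \<subseteq> - Q"
  proof
    assume *: "Fpow B \<inter> {s. s \<subseteq> A \<and> card s = 2} \<subseteq> - Q"
    obtain z where "z \<in> B" using BA(2) infinite_imp_nonempty by blast
    then obtain x where x: "x \<in> B" "\<And>y. y \<in> B \<Longrightarrow> f x \<le> f y"
      using ex_has_least_nat[of "\<lambda>x. x \<in> B" z f] by auto
    have "g y \<le> g x" if y: "y \<in> B" for y
    proof (cases "x = y")
      case False
      then have "{x, y} \<notin> Q" using pair[OF x(1) y] * by blast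
      moreover have "f x < f y" using x y False inj BA
        by (metis inj_on_def le_neq_implies_less subsetD)
      ultimately show ?thesis unfolding Q_def by auto
    qed simp
    then have "g ` B \<subseteq> {..g x}" by auto
    then show False using BA inj by (metis finite_atMost finite_imageD finite_subset inj_on_subset)
  qed
  then have "{x, y} \<in> Q" if "x \<in> B" "y \<in> B" "x \<noteq> y" for x y
    using hom pair[OF that] by blast
  then have "\<forall>x\<in>B. \<forall>y\<in>B. f x < f y \<longleftrightarrow> g x < g y" unfolding Q_def by blast
  with B show ?thesis by blast
qed

lemma FG_on_any_order:
  assumes e: "enumeration_choice e" and FG: "FG e X"
    and A: "A \<in> ctbl_inf_subsets A \<inter> Omega X" and a: "inj a" "A \<subseteq> range a"
  shows "FG_on X a A"
  unfolding FG_on_def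
proof (intro allI impI)
  fix \<S> assume \<S>: "dense_family X A \<S>"
  have bij: "bij_betw (e A) UNIV A"
    using e A by (auto simp: enumeration_choice_def ctbl_inf_subsets_def)
  then have eA: "inj (e A)" "range (e A) = A" by (auto simp: bij_betw_def)
  have FG_eA: "FG_on X (e A) A" using FG A by (auto simp: FG_def FG_on_def ctbl_inf_subsets_def)
  obtain B where B: "B \<in> ctbl_inf_subsets A \<inter> Omega X"
    and seg: "\<And>C. C \<in> ctbl_inf_subsets B \<inter> Omega X \<Longrightarrow> \<exists>s\<in>\<S>. initial_segment (e A) s C"
    using FG_eA \<S> unfolding FG_on_def by blast
  have BA: "B \<subseteq> A" "B \<in> ctbl_inf_subsets B \<inter> Omega X"
    using B by (auto simp: ctbl_inf_subsets_def)
  \<comment> \<open>The inverses return the positions of a point in the two enumerations. On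
    \<open>B'\<close> these positions are ordered alike, so subsets of \<open>B'\<close> have the
    same initial segments in both orders.\<close>
  have "inj_on (inv (e A)) B" "inj_on (inv a) B"
    using BA a eA by (auto intro!: inj_on_inv_into)
  then obtain B' where B': "B' \<in> ctbl_inf_subsets B \<inter> Omega X"
    and agree: "\<And>x y. x \<in> B' \<Longrightarrow> y \<in> B' \<Longrightarrow> inv (e A) x < inv (e A) y \<longleftrightarrow> inv a x < inv a y"
    using orders_agree_on_subcover[OF e FG BA(2)] by meson
  have "\<exists>s\<in>\<S>. initial_segment a s C" if C: "C \<in> ctbl_inf_subsets B' \<inter> Omega X" for C
  proof -
    have "C \<in> ctbl_inf_subsets B \<inter> Omega X" using ctbl_inf_subsets_trans B' C by blast
    then obtain s where s: "s \<in> \<S>" "initial_segment (e A) s C" using seg by blast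
    have C': "C \<subseteq> B'" "C \<subseteq> A" using C B' BA by (auto simp: ctbl_inf_subsets_def)
    have "n < m" if nm: "a n \<in> s" "a m \<in> C - s" for n m
    proof -
      have C_mem: "a n \<in> C" "a m \<in> C" using nm s(2) by (auto simp: initial_segment_def)
      then have "e A (inv (e A) (a n)) = a n" "e A (inv (e A) (a m)) = a m"
        using C' eA by (auto intro!: f_inv_into_f)
      then have "inv (e A) (a n) < inv (e A) (a m)"
        using s(2) nm unfolding initial_segment_def set_before_def by simp
      then have "inv a (a n) < inv a (a m)" using agree C' C_mem by blast
      then show ?thesis using a by simp
    qed
    then show ?thesis using s unfolding initial_segment_def set_before_def by blast
  qed
  then show "\<exists>B \<in> ctbl_inf_subsets A \<inter> Omega X.
      \<forall>C \<in> ctbl_inf_subsets B \<inter> Omega X. \<exists>s\<in>\<S>. initial_segment a s C"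
    using B B' ctbl_inf_subsets_trans by blast
qed

text \<open>The induction varies \<open>A\<close> and \<open>\<T>\<close> but fixes
  \<open>a\<close>. The last piece is played against the union of the others; if the union wins, the
  induction continues inside \<open>B\<close>.\<close>

lemma thin_finitely_many_pieces:
  assumes e: "enumeration_choice e" and FG: "FG e X" and a: "inj a"
    and "A \<in> ctbl_inf_subsets A \<inter> Omega X" "A \<subseteq> range a"
    and "thin_family a A \<T>" "\<T> \<subseteq> (\<Union>i\<in>{1..Suc n}. P i)"
  shows "\<exists>B \<in> ctbl_inf_subsets A \<inter> Omega X. \<exists>i\<in>{1..Suc n}. Fpow B \<inter> \<T> \<subseteq> P i"
  using assms(4-)
proof (induction n arbitrary: A \<T>)
  case 0
  then show ?case by (intro bexI[of _ A] bexI[of _ 1]) auto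
next
  case (Suc n)
  have "\<T> \<subseteq> P (Suc (Suc n)) \<union> (\<Union>i\<in>{1..Suc n}. P i)"
    using Suc.prems(4) by (auto simp: atLeastAtMostSuc_conv)
  from thin_two_pieces[OF a Suc.prems(2) FG_on_any_order[OF e FG Suc.prems(1) a Suc.prems(2)]
      Suc.prems(1,3) this]
  obtain B where B: "B \<in> ctbl_inf_subsets A \<inter> Omega X"
    and "Fpow B \<inter> \<T> \<subseteq> P (Suc (Suc n)) \<or> Fpow B \<inter> \<T> \<subseteq> (\<Union>i\<in>{1..Suc n}. P i)"
    by blast
  then consider "Fpow B \<inter> \<T> \<subseteq> P (Suc (Suc n))" | "Fpow B \<inter> \<T> \<subseteq> (\<Union>i\<in>{1..Suc n}. P i)"
    by blast
  then show ?case
  proof cases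
    case 1
    then show ?thesis using B by (intro bexI[of _ B] bexI[of _ "Suc (Suc n)"]) auto
  next
    case 2
    have BA: "B \<in> ctbl_inf_subsets B \<inter> Omega X" "B \<subseteq> range a"
      using B Suc.prems(2) by (auto simp: ctbl_inf_subsets_def)
    \<comment> \<open>Thinness passes to the subfamily because initial segments are still taken in
      the order \<open>a\<close>.\<close>
    have "thin_family a B (Fpow B \<inter> \<T>)"
      using Suc.prems(3) unfolding thin_family_def by blast
    from Suc.IH[OF BA this 2] obtain C i where
      C: "C \<in> ctbl_inf_subsets B \<inter> Omega X" "i \<in> {1..Suc n}" "Fpow C \<inter> (Fpow B \<inter> \<T>) \<subseteq> P i"
      by blast
    have "Fpow C \<subseteq> Fpow B" using C(1) by (intro Fpow_mono) (simp add: ctbl_inf_subsets_def)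
    then have "Fpow C \<inter> \<T> \<subseteq> P i" using C(3) by blast
    moreover have "C \<in> ctbl_inf_subsets A \<inter> Omega X" using B C(1) ctbl_inf_subsets_trans by blast
    moreover have "i \<in> {1..Suc (Suc n)}" using C(2) by simp
    ultimately show ?thesis by blast
  qed
qed

theorem theorem8:
  fixes X :: "'a topology"
    and e :: "'a set set \<Rightarrow> nat \<Rightarrow> 'a set"
  assumes "enumeration_choice e"
    and "FG e X"
  shows "NW e X"
  unfolding NW_def
proof (intro allI impI, elim conjE)
  fix A \<T> and n :: nat and P
  assume A: "A \<in> Omega X" "countable A" "infinite A" and thin: "thin_family (e A) A \<T>"
    and n: "n > 0" and \<T>: "\<T> = (\<Union>i\<in>{1..n}. P i)"
  obtain k where k: "n = Suc k" using n by (cases n) auto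
  have "bij_betw (e A) UNIV A" using assms(1) A by (simp add: enumeration_choice_def)
  then have "inj (e A)" "A \<subseteq> range (e A)" by (auto simp: bij_betw_def)
  moreover have "A \<in> ctbl_inf_subsets A \<inter> Omega X" using A by (simp add: ctbl_inf_subsets_def)
  ultimately show "\<exists>B \<in> ctbl_inf_subsets A \<inter> Omega X. \<exists>i\<in>{1..n}. Fpow B \<inter> \<T> \<subseteq> P i"
    using thin_finitely_many_pieces[OF assms, of "e A" A \<T> P k] thin \<T> k by simp
qed

end
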